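(* Let $\mathrm{SP}$ be the set of all subparticle representations (for a given index set), and define $'\mathtt{St}:\mathcal{P}(\mathrm{SP})\to\mathcal{P}(\mathrm{SP})$ by $'\mathtt{St}(X)=X\cup\mathtt{St}(X)$, where $\mathtt{St}(X)=\{\mathtt{st}(x)\mid x\in X\}$. Then $'\mathtt{St}$ is a finite consequence operator on $\mathrm{SP}$; that is, for each $X\subset\mathrm{SP}$, $$X\subset {}'\mathtt{St}(X)={}'\mathtt{St}({}'\mathtt{St}(X))\subset\mathrm{SP}\quad\text{and}\quad {}'\mathtt{St}(X)=\bigcup\{{}'\mathtt{St}(F)\mid F\in\mathcal{F}(X)\},$$ where $\mathcal{F}(X)$ denotes the set of all finite subsets of $X$.
   Context: ${}^*\mathbb{R}$ is a nonstandard extension of $\mathbb{R}$, ${}^*\mathbb{N}$ is the corresponding extension of $\mathbb{N}=\{0,1,2,\ldots\}$, and $G(0)\subset{}^*\mathbb{R}$ is the set of finite (limited) hyperreal numbers. $\mathtt{st}:G(0)\to\mathbb{R}$ is the standard part map, and $\mathbb{R}\subset G(0)$. Let $A$ be a nonempty (finite or infinite) set of positive natural numbers, used as the set of coordinate indices. Put $A_1=A_2={}^*\mathbb{N}$ and $A_i=G(0)$ for $i\ge 3$. A subparticle representation is a function $a:A\to\bigcup_{i\in A}A_i$ with $a(i)\in A_i$ for each $i\in A$, written $(a_1,a_2,a_3,a_4,\ldots)$. $\mathrm{SP}$ is the set of all of them. The standard part of a subparticle representation is defined coordinatewise, with the first two coordinates sent to $0$: $\mathtt{st}((a_1,a_2,a_3,a_4,\ldots))=(0,0,\mathtt{st}(a_3),\mathtt{st}(a_4),\ldots)\in\mathrm{SP}$.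 *)

theory Defs
  imports Complex_Main "HOL-Library.FuncSet"
begin

text \<open>
  First-order formulas over the full relational language of the real numbers: there is one
  relation symbol for every set of lists of reals, and an atom \<open>Rel R xs\<close> uses only the members
  of \<open>R\<close> of the same length as \<open>xs\<close>. Constants need no symbols, since they enter through the
  assignment of the free variables.
\<close>

datatype form =
    Eq nat nat
  | Rel "real list set" "nat list"
  | Neg form
  | Conj form form
  | Ex nat form

primrec sat :: "(real list set \<Rightarrow> 'a list set) \<Rightarrow> (nat \<Rightarrow> 'a) \<Rightarrow> form \<Rightarrow> bool" where
  "sat I e (Eq m n) \<longleftrightarrow> e m = e n"
| "sat I e (Rel R xs) \<longleftrightarrow> map e xs \<in> I R"
| "sat I e (Neg p) \<longleftrightarrow> \<not> sat I e p"
| "sat I e (Conj p q) \<longleftrightarrow> sat I e p \<and> sat I e q"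
| "sat I e (Ex n p) \<longleftrightarrow> (\<exists>x. sat I (e(n := x)) p)"

text \<open>
  The type \<open>'h\<close> plays the role of the hyperreal line, with the reals embedded by \<open>of_real\<close>, and
  \<open>star R\<close> is the nonstandard extension of the relation \<open>R\<close>. The extension has to satisfy
  transfer and be proper. The conditions \<open>less\<close>, \<open>add\<close> and \<open>mult\<close> say that the ordered field
  structure of \<open>'h\<close> is the one obtained by extending that of the reals.
\<close>

locale nonstandard_extension =
  fixes star :: "real list set \<Rightarrow> ('h::{linordered_field, real_algebra_1}) list set"
  assumes transfer: "\<And>p e. sat (\<lambda>R. R) e p \<longleftrightarrow> sat star (\<lambda>n. of_real (e n)) p"
    and less: "\<And>x y. [x, y] \<in> star {[a, b] |a b. a < b} \<longleftrightarrow> x < y"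
    and add: "\<And>x y z. [x, y, z] \<in> star {[a, b, a + b] |a b. True} \<longleftrightarrow> x + y = z"
    and mult: "\<And>x y z. [x, y, z] \<in> star {[a, b, a * b] |a b. True} \<longleftrightarrow> x * y = z"
    and proper: "range (of_real :: real \<Rightarrow> 'h) \<noteq> UNIV"

definition hypernaturals :: "(real list set \<Rightarrow> 'h list set) \<Rightarrow> 'h set" where
  "hypernaturals star = {x. [x] \<in> star {[real n] |n. True}}"

definition limited :: "('h::{linordered_field, real_algebra_1}) set" where
  "limited = {x. \<exists>r::real. \<bar>x\<bar> < of_real r}"

definition infinitesimal :: "('h::{linordered_field, real_algebra_1}) set" where
  "infinitesimal = {x. \<forall>r::real. 0 < r \<longrightarrow> \<bar>x\<bar> < of_real r}"

text \<open>Meaningful on limited arguments only.\<close>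

definition standard_part :: "('h::{linordered_field, real_algebra_1}) \<Rightarrow> real" where
  "standard_part x = (THE r. x - of_real r \<in> infinitesimal)"

definition coordinate_range ::
    "(real list set \<Rightarrow> ('h::{linordered_field, real_algebra_1}) list set) \<Rightarrow> nat \<Rightarrow> 'h set" where
  "coordinate_range star i = (if i = 1 \<or> i = 2 then hypernaturals star else limited)"

definition SP ::
    "(real list set \<Rightarrow> ('h::{linordered_field, real_algebra_1}) list set) \<Rightarrow> nat set
      \<Rightarrow> (nat \<Rightarrow> 'h) set" where
  "SP star A = (\<Pi>\<^sub>E i\<in>A. coordinate_range star i)"

definition sp_st ::
    "nat set \<Rightarrow> (nat \<Rightarrow> 'h) \<Rightarrow> nat \<Rightarrow> ('h::{linordered_field, real_algebra_1})" where
  "sp_st A a = (\<lambda>i\<in>A. if i = 1 \<or> i = 2 then 0 else of_real (standard_part (a i)))"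

definition St ::
    "nat set \<Rightarrow> (nat \<Rightarrow> ('h::{linordered_field, real_algebra_1})) set \<Rightarrow> (nat \<Rightarrow> 'h) set" where
  "St A X = {sp_st A x |x. x \<in> X}"

definition St' ::
    "nat set \<Rightarrow> (nat \<Rightarrow> ('h::{linordered_field, real_algebra_1})) set \<Rightarrow> (nat \<Rightarrow> 'h) set" where
  "St' A X = X \<union> St A X"

definition finite_consequence_operator :: "'a set \<Rightarrow> ('a set \<Rightarrow> 'a set) \<Rightarrow> bool" where
  "finite_consequence_operator L C \<longleftrightarrow>
    (\<forall>X. X \<subseteq> L \<longrightarrow>
      X \<subseteq> C X \<and> C X = C (C X) \<and> C (C X) \<subseteq> L \<and>
      C X = \<Union> {C F |F. finite F \<and> F \<subseteq> X})"

end

theory Submission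
  imports Defs
begin

text \<open>The standard part map on subparticles is a projection of \<open>SP\<close> into itself:
  it yields zeros and embedded reals, and a second application changes nothing, since real numbers
  are their own standard parts (\<open>sp_st_in_SP\<close>, \<open>sp_st_idem\<close>). Closure
  inside \<open>SP\<close> and idempotence of \<open>St'\<close> follow. As \<open>St'\<close> acts
  element by element, it commutes with unions, so singletons already witness finiteness.\<close>

lemma of_real_nonneg:
  assumes "0 \<le> r"
  shows "0 \<le> (of_real r :: 'h::{linordered_field, real_algebra_1})"
proof -
  \<comment> \<open>The type class postulates no link between \<open>of_real\<close> and the order.
    The link is algebraic: nonnegative reals are squares, and squares are nonnegative in every
    ordered field.\<close>
  have "(of_real r :: 'h) = of_real (sqrt r) * of_real (sqrt r)"
    using assms by (simp flip: of_real_mult)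
  then show ?thesis
    by simp
qed

lemma of_real_less_of_real:
  assumes "r < s"
  shows "(of_real r :: 'h::{linordered_field, real_algebra_1}) < of_real s"
proof -
  have "0 \<le> (of_real (s - r) :: 'h)"
    using assms by (intro of_real_nonneg) simp
  moreover have "(of_real s :: 'h) \<noteq> of_real r"
    using assms by simp
  ultimately show ?thesis
    by (auto simp: less_le)
qed

lemma abs_of_real:
  "\<bar>of_real r :: 'h::{linordered_field, real_algebra_1}\<bar> = of_real \<bar>r\<bar>"
  using of_real_nonneg[of r, where 'h = 'h] of_real_nonneg[of "- r", where 'h = 'h]
  by (cases "0 \<le> r") simp_all

lemma of_real_limited: "(of_real r :: 'h::{linordered_field, real_algebra_1}) \<in> limited"
proof -
  have "\<bar>of_real r :: 'h\<bar> < of_real (\<bar>r\<bar> + 1)"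
    unfolding abs_of_real by (intro of_real_less_of_real) simp
  then show ?thesis
    unfolding limited_def by blast
qed

lemma of_real_infinitesimal_iff:
  "(of_real r :: 'h::{linordered_field, real_algebra_1}) \<in> infinitesimal \<longleftrightarrow> r = 0"
proof
  assume "(of_real r :: 'h) \<in> infinitesimal"
  \<comment> \<open>A nonzero real violates the bound given by its own absolute value.\<close>
  then have "0 < \<bar>r\<bar> \<Longrightarrow> \<bar>of_real r :: 'h\<bar> < of_real \<bar>r\<bar>"
    unfolding infinitesimal_def by blast
  then show "r = 0"
    by (auto simp: abs_of_real)
next
  assume "r = 0"
  then show "(of_real r :: 'h) \<in> infinitesimal"
    using of_real_less_of_real[of 0, where 'h = 'h] by (simp add: infinitesimal_def)
qed

text \<open>Two reals at infinitesimal distance coincide, so the \<open>THE\<close> in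
  \<open>standard_part\<close> has exactly one candidate.\<close>

lemma standard_part_of_real:
  "standard_part (of_real r :: 'h::{linordered_field, real_algebra_1}) = r"
proof -
  have "(of_real r - of_real s :: 'h) \<in> infinitesimal \<longleftrightarrow> s = r" for s
    using of_real_infinitesimal_iff[of "r - s", where 'h = 'h] by auto
  then show ?thesis
    unfolding standard_part_def by simp
qed

lemma (in nonstandard_extension) zero_in_hypernaturals: "0 \<in> hypernaturals star"
proof -
  have "[0] \<in> {[real n] |n. True}"
    by (auto intro: exI[of _ 0])
  then show ?thesis
    \<comment> \<open>Transfer of one atomic formula; the final \<open>[0]\<close> is the list of
      variable indices, and variable 0 is assigned the value 0.\<close>
    using transfer[of "\<lambda>_. 0" "Rel {[real n] |n. True} [0]"]
    by (simp add: hypernaturals_def)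
qed

text \<open>Coordinates 1 and 2 become the hypernatural 0. Elsewhere \<open>standard_part\<close>
  returns some real whatever its argument, and embedded reals are limited.\<close>

lemma (in nonstandard_extension) sp_st_in_SP: "sp_st A x \<in> SP star A"
  unfolding sp_st_def SP_def
  by (auto simp: coordinate_range_def zero_in_hypernaturals of_real_limited)

lemma sp_st_idem: "sp_st A (sp_st A x) = sp_st A x"
  by (auto simp: sp_st_def standard_part_of_real fun_eq_iff)

theorem mainTheorem5:
  fixes star :: "real list set \<Rightarrow> ('h::{linordered_field, real_algebra_1}) list set"
    and A :: "nat set"
  assumes "nonstandard_extension star"
    and "A \<noteq> {}"
    and "\<And>i. i \<in> A \<Longrightarrow> 0 < i"
  shows "finite_consequence_operator (SP star A) (St' A)"
  unfolding finite_consequence_operator_def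
proof (intro allI impI conjI)
  fix X :: "(nat \<Rightarrow> 'h) set"
  assume X: "X \<subseteq> SP star A"
  show "X \<subseteq> St' A X"
    by (simp add: St'_def)
  show idem: "St' A X = St' A (St' A X)"
    by (auto simp: St'_def St_def sp_st_idem)
  show "St' A (St' A X) \<subseteq> SP star A"
    unfolding idem[symmetric] using X nonstandard_extension.sp_st_in_SP[OF assms(1)]
    by (auto simp: St'_def St_def)
  show "St' A X = \<Union> {St' A F |F. finite F \<and> F \<subseteq> X}"
  proof
    \<comment> \<open>Each element of \<open>St' A X\<close> depends on a single member of
      \<open>X\<close>.\<close>
    have "St' A X = (\<Union>x\<in>X. St' A {x})"
      by (auto simp: St'_def St_def)
    also have "\<dots> \<subseteq> \<Union> {St' A F |F. finite F \<and> F \<subseteq> X}"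
      by (intro UN_least Union_upper) blast
    finally show "St' A X \<subseteq> \<Union> {St' A F |F. finite F \<and> F \<subseteq> X}" .
    \<comment> \<open>This is monotonicity of \<open>St'\<close>.\<close>
    show "\<Union> {St' A F |F. finite F \<and> F \<subseteq> X} \<subseteq> St' A X"
      by (auto simp: St'_def St_def)
  qed
qed

end
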